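(* Let $\Omega\subset\mathbb{X}$ be a closed set, let $r\in\{1,\ldots,n\}$, and suppose $\Gamma_r:=\{X\in\Omega\,|\,\mathrm{rank}(X)\le r\}$ is nonempty. Let $\Delta\subseteq\mathbb{X}$ be a compact set. If the mapping $\mathcal{S}_r$ is calm at $0$ for any $X\in\mathcal{S}_r(0)$, then there exists a constant $\kappa'>0$ such that for all $X\in\Delta\cap\Omega$, $$\mathrm{dist}(X,\Gamma_r)\le\kappa'\big[\|X\|_*-\|X\|_{(r)}\big].$$
   Context: $\mathbb{X}$ denotes either $\mathbb{R}^{n\times m}$ (with $n\le m$) or the space $\mathbb{S}^n$ of $n\times n$ real symmetric matrices, equipped with the trace inner product and the Frobenius norm. $\sigma_1(X)\ge\cdots\ge\sigma_n(X)$ are the singular values of $X$; $\|X\|_*=\sum_{i=1}^n\sigma_i(X)$ is the nuclear norm and $\|X\|_{(r)}=\sum_{i=1}^r\sigma_i(X)$ is the Ky-Fan $r$-norm. The multifunction $\mathcal{S}_r:\mathbb{R}\rightrightarrows\mathbb{X}$ is $\mathcal{S}_r(\tau):=\{X\in\Omega\,|\,\|X\|_*-\|X\|_{(r)}=\tau\}$, so $\mathcal{S}_r(0)=\Gamma_r$. $\mathrm{dist}(X,C)$ is the Frobenius-norm distance from $X$ to $C$. Calmness: a multifunction $\mathcal{M}:\mathbb{Y}\rightrightarrows\mathbb{Z}$ between finite-dimensional Euclidean spaces is calm at $\overline{y}$ for $\overline{z}\in\mathcal{M}(\overline{y})$ if there exist $\gamma\ge0$, $\varepsilon>0$, $\delta>0$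 such that for all $y$ with $\|y-\overline{y}\|\le\varepsilon$, $\mathcal{M}(y)\cap\mathbb{B}(\overline{z},\delta)\subseteq\mathcal{M}(\overline{y})+\gamma\|y-\overline{y}\|\mathbb{B}_{\mathbb{Z}}$, where $\mathbb{B}(\overline z,\delta)$ is the closed ball and $\mathbb{B}_{\mathbb{Z}}$ the closed unit ball. *)

theory Defs
  imports "HOL-Analysis.Analysis" "HOL-Computational_Algebra.Polynomial"
begin

text \<open>
  An $n \times m$ matrix has type \<open>real ^ 'm ^ 'n\<close>: the outer index \<open>'n\<close> numbers the rows.
  The norm, distance and inner product that the library puts on this type are the Frobenius norm,
  the Frobenius distance and the trace inner product.
\<close>

definition symmetric_matrices :: "(real ^ 'n ^ 'n) set" where
  "symmetric_matrices = {X. transpose X = X}"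

definition charpoly :: "'a::comm_ring_1 ^ 'n ^ 'n \<Rightarrow> 'a poly" where
  "charpoly A = det (\<chi> i j. (if i = j then [:0, 1:] else 0) - [:A $ i $ j:])"

text \<open>
  The real eigenvalues in nonincreasing order, each repeated according to its algebraic
  multiplicity. For a symmetric matrix these are all the eigenvalues, so the list has length
  \<open>CARD('n)\<close>.
\<close>

definition eigenvalues_desc :: "real ^ 'n ^ 'n \<Rightarrow> real list" where
  "eigenvalues_desc A = rev (sorted_list_of_multiset (proots (charpoly A)))"

text \<open>
  The $i$-th largest singular value, \<open>1 \<le> i \<le> CARD('n)\<close>, of a matrix with at most as many rows
  as columns: the square root of the $i$-th largest eigenvalue of $X X^T$. The value is
  unspecified for other \<open>i\<close>.
\<close>

definition singular_value :: "nat \<Rightarrow> real ^ 'm ^ 'n \<Rightarrow> real" where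
  "singular_value i X = sqrt (eigenvalues_desc (X ** transpose X) ! (i - 1))"

definition ky_fan_norm :: "nat \<Rightarrow> real ^ 'm ^ 'n \<Rightarrow> real" where
  "ky_fan_norm r X = (\<Sum>i = 1..r. singular_value i X)"

definition nuclear_norm :: "real ^ 'm ^ 'n \<Rightarrow> real" where
  "nuclear_norm (X :: real ^ 'm ^ 'n) = (\<Sum>i = 1..CARD('n). singular_value i X)"

definition rank_constrained :: "(real ^ 'm ^ 'n) set \<Rightarrow> nat \<Rightarrow> (real ^ 'm ^ 'n) set" where
  "rank_constrained \<Omega> r = {X \<in> \<Omega>. rank X \<le> r}"

definition S_map :: "(real ^ 'm ^ 'n) set \<Rightarrow> nat \<Rightarrow> real \<Rightarrow> (real ^ 'm ^ 'n) set" where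
  "S_map \<Omega> r \<tau> = {X \<in> \<Omega>. nuclear_norm X - ky_fan_norm r X = \<tau>}"

text \<open>
  Calmness at \<open>y0\<close> for \<open>z0\<close> of a multifunction whose values lie in the subspace \<open>Z\<close> of the type;
  both balls are balls of \<open>Z\<close>.
\<close>

definition calm_at ::
  "'z::euclidean_space set \<Rightarrow> ('y::euclidean_space \<Rightarrow> 'z set) \<Rightarrow> 'y \<Rightarrow> 'z \<Rightarrow> bool" where
  "calm_at Z M y0 z0 \<longleftrightarrow> z0 \<in> M y0 \<and>
    (\<exists>\<gamma>\<ge>0. \<exists>\<epsilon>>0. \<exists>\<delta>>0. \<forall>y. norm (y - y0) \<le> \<epsilon> \<longrightarrow>
      M y \<inter> (cball z0 \<delta> \<inter> Z) \<subseteq>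
        {z + (\<gamma> * norm (y - y0)) *\<^sub>R u | z u. z \<in> M y0 \<and> u \<in> cball 0 1 \<inter> Z})"

end

theory Submission
  imports Defs
begin

text \<open>
  Write \<open>\<phi>(X)\<close> for the nuclear norm minus the Ky-Fan \<open>r\<close>-norm, that is, the sum of the singular
  values after the \<open>r\<close>-th. It is nonnegative, and it vanishes exactly when the rank is at most \<open>r\<close>,
  so \<open>S\<^sub>r(0)\<close> is the rank-constrained set and \<open>\<phi>\<close> is a residual for it. Calmness at a point \<open>X\<close> of
  this set gives the error bound for the points of \<open>\<Omega>\<close> near \<open>X\<close>: each of them lies in the level set
  \<open>S\<^sub>r(\<tau>)\<close> with \<open>\<tau>\<close> its own residual. Near a point outside the set, \<open>\<phi>\<close> is bounded away from \<open>0\<close>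
  while the distance is bounded, so the bound holds with some constant there too. Finitely many of
  these neighbourhoods cover the compact set \<open>\<Delta> \<inter> \<Omega>\<close>. This argument, for a
  general residual, is \<open>calm_level_sets_imp_error_bound\<close>.

  The properties of \<open>\<phi>\<close> are facts on singular values, which are given as sorted roots of the
  characteristic polynomial of the Gram matrix \<open>X X\<^sup>T\<close>. The spectral theorem turns them into data of
  linear algebra: in an orthonormal basis of eigenvectors of \<open>X X\<^sup>T\<close> the polynomial splits into
  linear factors, and \<open>c \<le> \<sigma>\<^sub>k(X)\<close> says that at least \<open>k\<close> basis vectors have an eigenvalue of at
  least \<open>c\<^sup>2\<close> (\<open>singular_value_ge_iff\<close>). Eigenvectors with a nonzero eigenvalue lie in the range of
  \<open>X\<close>, so \<open>\<sigma>\<^sub>k(X) = 0\<close> for \<open>k\<close> above the rank. Conversely \<open>\<sigma>\<^sub>k(X) \<ge> c\<close> as soon as \<open>X\<^sup>T\<close> stretches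
  each vector of some subspace of dimension at least \<open>k\<close> by at least the factor \<open>c\<close>, which is one half of the
  Courant-Fischer principle. This condition survives a small perturbation of \<open>X\<close> with \<open>c/2\<close> in place
  of \<open>c\<close>, and the range of \<open>X\<close> is such a subspace. Hence \<open>\<sigma>\<^sub>k\<close> with \<open>k\<close> at most the rank of \<open>X\<close> is
  positive at \<open>X\<close> and bounded below near \<open>X\<close>.
\<close>

section \<open>The spectral theorem for real symmetric matrices\<close>

definition orthonormal_eigenvectors :: "real ^ 'n ^ 'n \<Rightarrow> (real ^ 'n) set \<Rightarrow> bool" where
  "orthonormal_eigenvectors A B \<longleftrightarrow>
     pairwise orthogonal B \<and> (\<forall>v\<in>B. norm v = 1 \<and> (\<exists>l. A *v v = l *\<^sub>R v))"

lemma symmetric_inner_commute: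
  fixes A :: "real ^ 'n ^ 'n"
  assumes "transpose A = A"
  shows "x \<bullet> (A *v y) = (A *v x) \<bullet> y"
  by (metis assms dot_lmul_matrix transpose_matrix_vector)

text \<open>
  The first-order condition at an interior minimum, for a quadratic function of one variable.
\<close>

lemma linear_coefficient_zero_if_quadratic_nonneg:
  fixes a b :: real
  assumes "\<And>t. 0 \<le> 2 * t * b + t\<^sup>2 * a"
  shows "b = 0"
proof (rule ccontr)
  assume "b \<noteq> 0"
  \<comment> \<open>At \<open>t = - b / s\<close> the quadratic is negative, since \<open>a < 2 s\<close>.\<close>
  define s where "s = \<bar>a\<bar> + 1"
  have "s > 0" "a < 2 * s" by (auto simp: s_def)
  have "0 \<le> 2 * (- b / s) * b + (- b / s)\<^sup>2 * a" by (rule assms)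
  also have "\<dots> = (b\<^sup>2 / s\<^sup>2) * (a - 2 * s)"
    using \<open>s > 0\<close> by (simp add: field_simps power2_eq_square)
  also have "\<dots> < 0"
    using \<open>b \<noteq> 0\<close> \<open>s > 0\<close> \<open>a < 2 * s\<close> by (intro mult_pos_neg) auto
  finally show False by simp
qed

text \<open>
  The eigenvector maximises the Rayleigh quotient over the unit sphere of \<open>S\<close>. The variation of the
  quotient in the direction \<open>A v - l v\<close>, which stays in \<open>S\<close>, shows that this vector is orthogonal to
  itself.
\<close>

lemma invariant_subspace_has_eigenvector:
  fixes A :: "real ^ 'n ^ 'n"
  assumes A: "transpose A = A" and S: "subspace S" and nz: "\<exists>x\<in>S. x \<noteq> 0"
    and inv: "\<And>x. x \<in> S \<Longrightarrow> A *v x \<in> S"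
  obtains v l where "v \<in> S" "norm v = 1" "A *v v = l *\<^sub>R v"
proof -
  define f where "f = (\<lambda>x. x \<bullet> (A *v x))"
  have cont: "continuous_on UNIV f"
    unfolding f_def by (intro continuous_intros matrix_vector_mult_linear_continuous_on)
  have "compact (S \<inter> sphere 0 1)"
    by (intro closed_Int_compact closed_subspace S) auto
  moreover from nz obtain x where "x \<in> S" "x \<noteq> 0" by blast
  then have "x /\<^sub>R norm x \<in> S \<inter> sphere 0 1"
    using S by (auto simp: subspace_scale)
  then have "S \<inter> sphere 0 1 \<noteq> {}" by blast
  ultimately have "\<exists>v\<in>S \<inter> sphere 0 1. \<forall>x\<in>S \<inter> sphere 0 1. f x \<le> f v"
    using continuous_on_subset[OF cont] by (intro continuous_attains_sup) auto
  then obtain v where v: "v \<in> S" "norm v = 1"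
    and max: "\<And>x. x \<in> S \<Longrightarrow> norm x = 1 \<Longrightarrow> f x \<le> f v"
    by (auto simp del: One_nat_def)
  define l where "l = f v"
  have le: "f x \<le> l * (x \<bullet> x)" if "x \<in> S" for x
  proof (cases "x = 0")
    case False
    have "f (x /\<^sub>R norm x) \<le> l"
      unfolding l_def using False that S by (intro max) (auto simp: subspace_scale)
    moreover have "f (x /\<^sub>R norm x) = f x / (norm x)\<^sup>2"
      by (simp add: f_def matrix_vector_mult_scaleR power2_eq_square field_simps)
    ultimately show ?thesis
      using False by (simp add: divide_le_eq power2_norm_eq_inner)
  qed (simp add: f_def)
  define w where "w = A *v v - l *\<^sub>R v"
  have wS: "w \<in> S" unfolding w_def using S v inv by (intro subspace_diff) (auto simp: subspace_scale)
  have "w \<bullet> w = 0"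
  proof -
    have "0 \<le> 2 * t * (- (w \<bullet> w)) + t\<^sup>2 * (l * (w \<bullet> w) - f w)" for t
    proof -
      have val: "f (v + t *\<^sub>R w) = l + 2 * t * (w \<bullet> (A *v v)) + t\<^sup>2 * f w"
        using symmetric_inner_commute[OF A, of v w]
        by (simp add: f_def l_def algebra_simps matrix_vector_right_distrib
            matrix_vector_mult_scaleR inner_simps power2_eq_square inner_commute)
      have sq: "(v + t *\<^sub>R w) \<bullet> (v + t *\<^sub>R w) = 1 + 2 * t * (w \<bullet> v) + t\<^sup>2 * (w \<bullet> w)"
        using v by (simp add: inner_simps power2_eq_square inner_commute norm_eq_1 algebra_simps)
      have "w \<bullet> (A *v v) = w \<bullet> (w + l *\<^sub>R v)" by (simp add: w_def)
      then have wA: "w \<bullet> (A *v v) = w \<bullet> w + l * (w \<bullet> v)" by (simp only: inner_simps)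
      have "f (v + t *\<^sub>R w) \<le> l * ((v + t *\<^sub>R w) \<bullet> (v + t *\<^sub>R w))"
        using S v wS by (intro le) (auto intro: subspace_add subspace_scale)
      then show ?thesis unfolding val sq wA by (simp add: algebra_simps)
    qed
    from linear_coefficient_zero_if_quadratic_nonneg[OF this] show ?thesis by simp
  qed
  then have "A *v v = l *\<^sub>R v" by (simp add: w_def)
  with v show ?thesis by (rule that)
qed

lemma orthonormal_eigenvectors_independent:
  "orthonormal_eigenvectors A B \<Longrightarrow> independent B"
  unfolding orthonormal_eigenvectors_def
  by (intro pairwise_orthogonal_independent) force+

text \<open>
  An orthonormal set of eigenvectors of largest cardinality spans the space: its orthogonal
  complement is invariant because \<open>A\<close> is symmetric, and an eigenvector in the complement would
  enlarge the set. Indexing the basis by the row type \<open>'n\<close> lets it serve as a matrix later.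
\<close>

lemma symmetric_eigenbasis:
  fixes A :: "real ^ 'n ^ 'n"
  assumes A: "transpose A = A"
  obtains e :: "'n \<Rightarrow> real ^ 'n" and l
  where "\<And>i j. e i \<bullet> e j = (if i = j then 1 else 0)" "\<And>i. A *v e i = l i *\<^sub>R e i"
    "\<And>x. (\<Sum>i\<in>UNIV. (x \<bullet> e i) *\<^sub>R e i) = x"
proof -
  have "orthonormal_eigenvectors A {}" by (simp add: orthonormal_eigenvectors_def)
  moreover have bound: "\<forall>B. orthonormal_eigenvectors A B \<longrightarrow> card B < Suc (CARD('n))"
    using orthonormal_eigenvectors_independent independent_bound by fastforce
  ultimately obtain B where B: "orthonormal_eigenvectors A B"
    and max: "\<And>C. orthonormal_eigenvectors A C \<Longrightarrow> card C \<le> card B"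
    using ex_has_greatest_nat[of "orthonormal_eigenvectors A" "{}" card] by blast
  have ind: "independent B" using B by (rule orthonormal_eigenvectors_independent)
  have fin: "finite B" using ind independent_bound by blast
  define S where "S = {x. \<forall>b\<in>B. orthogonal b x}"
  have "S = orthogonal_comp B" by (auto simp: S_def orthogonal_comp_def)
  then have subS: "subspace S" by (simp add: subspace_orthogonal_comp)
  have inv: "A *v x \<in> S" if "x \<in> S" for x
    unfolding S_def
  proof safe
    fix b assume "b \<in> B"
    then obtain l where "A *v b = l *\<^sub>R b" using B by (auto simp: orthonormal_eigenvectors_def)
    then show "orthogonal b (A *v x)"
      using that \<open>b \<in> B\<close> by (simp add: orthogonal_def symmetric_inner_commute[OF A] S_def)
  qed
  have "span B = UNIV"
  proof (rule ccontr)
    assume "span B \<noteq> UNIV"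
    then have "span B \<subset> span UNIV" by auto
    then obtain x where "x \<noteq> 0" and x: "\<And>y. y \<in> span B \<Longrightarrow> orthogonal x y"
      by (metis orthogonal_to_subspace_exists_gen)
    then have "x \<in> S" by (auto simp: S_def orthogonal_commute span_base)
    with \<open>x \<noteq> 0\<close> obtain v l where v: "v \<in> S" "norm v = 1" "A *v v = l *\<^sub>R v"
      using invariant_subspace_has_eigenvector[OF A subS _ inv] by blast
    have "v \<notin> B" using v by (auto simp: S_def orthogonal_self)
    have "orthonormal_eigenvectors A (insert v B)"
      using B v by (auto simp: orthonormal_eigenvectors_def pairwise_insert S_def orthogonal_commute)
    from max[OF this] \<open>v \<notin> B\<close> fin show False by simp
  qed
  then have "card B = CARD('n)"
    using ind by (metis dim_eq_card_independent dim_span DIM_cart DIM_real dim_UNIV mult.right_neutral)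
  then obtain e where e: "bij_betw e (UNIV :: 'n set) B"
    using fin by (metis finite_same_card_bij finite_class.finite_UNIV)
  have eB: "e i \<in> B" for i using e by (auto simp: bij_betw_def)
  have "e i \<bullet> e j = (if i = j then 1 else 0)" for i j
  proof (cases "i = j")
    case True
    then show ?thesis using B eB[of j] by (simp add: orthonormal_eigenvectors_def norm_eq_1)
  next
    case False
    then have "e i \<noteq> e j" using e by (auto simp: bij_betw_def inj_on_def)
    with False show ?thesis
      using B eB by (auto simp: orthonormal_eigenvectors_def pairwise_def orthogonal_def)
  qed
  moreover have "(\<Sum>i\<in>UNIV. (x \<bullet> e i) *\<^sub>R e i) = x" for x
    using orthonormal_basis_expand[of B x] B fin \<open>span B = UNIV\<close>
    by (simp add: sum.reindex_bij_betw[OF e, of "\<lambda>b. (x \<bullet> b) *\<^sub>R b"] orthonormal_eigenvectors_def)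
  moreover have "\<forall>i. \<exists>l. A *v e i = l *\<^sub>R e i"
    using B eB unfolding orthonormal_eigenvectors_def by blast
  then obtain l where "\<And>i. A *v e i = l i *\<^sub>R e i" by metis
  ultimately show ?thesis using that by blast
qed

section \<open>The characteristic polynomial in an eigenbasis\<close>

definition const_poly_matrix :: "'a::comm_ring_1 ^ 'n ^ 'm \<Rightarrow> 'a poly ^ 'n ^ 'm" where
  "const_poly_matrix A = (\<chi> i j. [:A $ i $ j:])"

lemma const_poly_sum: "[:\<Sum>i\<in>I. f i:] = (\<Sum>i\<in>I. [:f i:])"
proof (induction I rule: infinite_finite_induct)
  case (insert x F)
  show ?case by (simp add: insert.hyps insert.IH[symmetric])
qed auto

lemma const_poly_matrix_mult:
  "const_poly_matrix (A ** B) = const_poly_matrix A ** const_poly_matrix B"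
  by (simp add: const_poly_matrix_def matrix_matrix_mult_def vec_eq_iff const_poly_sum mult.commute)

lemma matrix_mult_diff_distrib:
  fixes A :: "'a::ring_1 ^ 'n ^ 'm"
  shows "A ** (B - C) = A ** B - A ** C"
  by (simp add: vec_eq_iff matrix_matrix_mult_def right_diff_distrib sum_subtractf)

lemma matrix_mult_diff_rdistrib:
  fixes A :: "'a::ring_1 ^ 'n ^ 'm"
  shows "(A - B) ** C = A ** C - B ** C"
  by (simp add: vec_eq_iff matrix_matrix_mult_def left_diff_distrib sum_subtractf)

text \<open>
  Over the polynomial ring, \<open>x I - P A Q = P (x I - A) Q\<close> because scalar matrices commute with \<open>P\<close>,
  and the determinants of \<open>P\<close> and \<open>Q\<close> cancel.
\<close>

lemma charpoly_similar:
  fixes A P Q :: "'a::comm_ring_1 ^ 'n ^ 'n"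
  assumes PQ: "P ** Q = mat 1"
  shows "charpoly (P ** A ** Q) = charpoly A"
proof -
  let ?C = const_poly_matrix
  have charpoly_eq: "charpoly M = det (mat [:0, 1:] - ?C M)" for M :: "'a ^ 'n ^ 'n"
    unfolding charpoly_def by (rule arg_cong[of _ _ det])
      (simp add: vec_eq_iff mat_def const_poly_matrix_def)
  have comm: "?C P ** mat [:0, 1:] = mat [:0, 1:] ** ?C P"
    by (simp add: vec_eq_iff matrix_matrix_mult_def mat_def if_distrib if_distribR
        sum.delta sum.delta' cong: if_cong)
  have one: "?C P ** ?C Q = mat 1"
    by (simp add: const_poly_matrix_mult[symmetric] PQ)
      (simp add: const_poly_matrix_def mat_def vec_eq_iff one_pCons)
  have "?C P ** mat [:0, 1:] ** ?C Q = mat [:0, 1:]"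
    by (simp add: comm matrix_mul_assoc[symmetric] one)
  then have "mat [:0, 1:] - ?C (P ** A ** Q) = ?C P ** (mat [:0, 1:] - ?C A) ** ?C Q"
    by (simp add: const_poly_matrix_mult matrix_mult_diff_distrib matrix_mult_diff_rdistrib)
  then have "charpoly (P ** A ** Q) = det (?C P ** ?C Q) * charpoly A"
    by (simp add: charpoly_eq det_mul)
  then show ?thesis by (simp add: one)
qed

lemma proots_charpoly_diagonal:
  fixes D :: "'a::idom ^ 'n ^ 'n"
  assumes "\<And>i j. i \<noteq> j \<Longrightarrow> D $ i $ j = 0"
  shows "proots (charpoly D) = image_mset (\<lambda>i. D $ i $ i) (mset_set UNIV)"
proof -
  have "charpoly D = (\<Prod>i\<in>UNIV. [:- (D $ i $ i), 1:])"
    unfolding charpoly_def by (subst det_diagonal) (auto simp: assms)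
  then show ?thesis by (simp add: proots_prod sum_unfold_sum_mset)
qed

text \<open>
  The matrix \<open>P\<close> with rows \<open>e i\<close> is orthogonal and diagonalises \<open>A\<close>, so the roots of the
  characteristic polynomial are the \<open>l i\<close> with their multiplicities.
\<close>

lemma eigenvalues_desc_eigenbasis:
  fixes A :: "real ^ 'n ^ 'n"
  assumes orth: "\<And>i j. e i \<bullet> e j = (if i = j then 1 else 0)"
    and eig: "\<And>i. A *v e i = l i *\<^sub>R e i"
  shows "eigenvalues_desc A = rev (sorted_list_of_multiset (image_mset l (mset_set (UNIV :: 'n set))))"
proof -
  define P where "P = (\<chi> i. e i)"
  have one: "P ** transpose P = mat 1"
    using orth by (simp add: P_def vec_eq_iff transpose_def mat_def matrix_matrix_mult_def inner_vec_def)
  have ent: "(P ** A ** transpose P) $ i $ j = (if i = j then l i else 0)" for i j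
  proof -
    have "(P ** A ** transpose P) $ i $ j = e i \<bullet> (A *v e j)"
      by (simp add: P_def matrix_mul_assoc[symmetric])
        (simp add: matrix_matrix_mult_def transpose_def inner_vec_def matrix_vector_mult_def)
    then show ?thesis by (simp add: eig orth)
  qed
  have "proots (charpoly A) = proots (charpoly (P ** A ** transpose P))"
    by (simp add: charpoly_similar[OF one])
  also have "\<dots> = image_mset l (mset_set UNIV)"
    by (subst proots_charpoly_diagonal) (simp_all add: ent)
  finally show ?thesis by (simp add: eigenvalues_desc_def)
qed

section \<open>Singular values\<close>

text \<open>
  Replaces positions in a sorted list by counting, which is how dimensions enter.
\<close>

lemma nth_rev_sorted_ge_iff:
  fixes M :: "'a::linorder multiset"
  assumes "i < size M"
  shows "c \<le> rev (sorted_list_of_multiset M) ! i \<longleftrightarrow> i < size (filter_mset (\<lambda>x. c \<le> x) M)"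
proof -
  define xs where "xs = rev (sorted_list_of_multiset M)"
  have mset: "mset xs = M" by (simp add: xs_def)
  have i: "i < length xs" using assms mset size_mset by metis
  have "sorted_wrt (\<ge>) xs" by (simp add: xs_def sorted_wrt_rev)
  then have anti: "xs ! k \<le> xs ! j" if "j \<le> k" "k < length xs" for j k
    using that by (cases "j = k") (auto simp: sorted_wrt_iff_nth_less)
  let ?J = "{j. j < length xs \<and> c \<le> xs ! j}"
  have "size (filter_mset (\<lambda>x. c \<le> x) M) = card ?J"
    unfolding mset[symmetric] by (simp add: length_filter_conv_card flip: mset_filter)
  moreover have "i < card ?J" if "c \<le> xs ! i"
  proof -
    have "{..i} \<subseteq> ?J" using anti i that by force
    from card_mono[OF _ this] show ?thesis by simp
  qed
  moreover have "card ?J \<le> i" if "\<not> c \<le> xs ! i"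
  proof -
    have "?J \<subseteq> {..<i}" using anti[of i] that by (force simp: not_le)
    from card_mono[OF _ this] show ?thesis by simp
  qed
  ultimately show ?thesis unfolding xs_def[symmetric] by linarith
qed

text \<open>
  An orthonormal basis of left singular vectors with the squared singular values, in no particular
  order. The middle condition states completeness of the orthonormal family as an expansion formula.
\<close>

definition left_singular_basis ::
    "real ^ 'm ^ 'n \<Rightarrow> ('n \<Rightarrow> real ^ 'n) \<Rightarrow> ('n \<Rightarrow> real) \<Rightarrow> bool" where
  "left_singular_basis X e l \<longleftrightarrow>
     (\<forall>i j. e i \<bullet> e j = (if i = j then 1 else 0)) \<and>
     (\<forall>x. (\<Sum>i\<in>UNIV. (x \<bullet> e i) *\<^sub>R e i) = x) \<and>
     (\<forall>i. X *v (transpose X *v e i) = l i *\<^sub>R e i)"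

lemma left_singular_basisD:
  assumes "left_singular_basis X e l"
  shows "e i \<bullet> e j = (if i = j then 1 else 0)"
    and "(\<Sum>i\<in>UNIV. (x \<bullet> e i) *\<^sub>R e i) = x"
    and "X *v (transpose X *v e i) = l i *\<^sub>R e i"
  using assms by (simp_all add: left_singular_basis_def)

lemma left_singular_basis_exists:
  fixes X :: "real ^ 'm ^ 'n"
  obtains e l where "left_singular_basis X e l"
proof -
  let ?A = "X ** transpose X"
  have sym: "transpose ?A = ?A" by (simp add: matrix_transpose_mul)
  show ?thesis
  proof (rule symmetric_eigenbasis[OF sym])
    fix e :: "'n \<Rightarrow> real ^ 'n" and l
    assume orth: "\<And>i j. e i \<bullet> e j = (if i = j then 1 else 0)"
      and eig: "\<And>i. ?A *v e i = l i *\<^sub>R e i"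
      and exp: "\<And>x. (\<Sum>i\<in>UNIV. (x \<bullet> e i) *\<^sub>R e i) = x"
    have "left_singular_basis X e l"
      unfolding left_singular_basis_def matrix_vector_mul_assoc
      by (intro conjI allI orth exp eig)
    then show ?thesis by (rule that)
  qed
qed

text \<open>
  All that is used later of the definition of singular values. A lower bound on an entry of a
  nonincreasing list is a lower bound on the number of large entries, so the order of the list
  disappears.
\<close>

lemma singular_value_ge_iff:
  fixes X :: "real ^ 'm ^ 'n"
  assumes basis: "left_singular_basis X e l" and k: "k \<in> {1..CARD('n)}" and c: "0 \<le> c"
  shows "c \<le> singular_value k X \<longleftrightarrow> k \<le> card {i. c\<^sup>2 \<le> l i}"
proof -
  let ?A = "X ** transpose X"
  have eig: "?A *v e i = l i *\<^sub>R e i" for i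
    using left_singular_basisD(3)[OF basis] by (simp only: matrix_vector_mul_assoc)
  have list: "eigenvalues_desc ?A = rev (sorted_list_of_multiset (image_mset l (mset_set UNIV)))"
    by (rule eigenvalues_desc_eigenbasis[OF left_singular_basisD(1)[OF basis] eig])
  have "c \<le> singular_value k X \<longleftrightarrow> c\<^sup>2 \<le> eigenvalues_desc ?A ! (k - 1)"
    unfolding singular_value_def using c by (metis real_sqrt_abs abs_of_nonneg real_sqrt_le_iff)
  also have "\<dots> \<longleftrightarrow> k - 1 < size (filter_mset (\<lambda>x. c\<^sup>2 \<le> x) (image_mset l (mset_set UNIV)))"
    unfolding list using k by (intro nth_rev_sorted_ge_iff) auto
  also have "\<dots> \<longleftrightarrow> k \<le> card {i. c\<^sup>2 \<le> l i}"
    using k by (auto simp: filter_mset_image_mset filter_mset_mset_set)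
  finally show ?thesis .
qed

lemma left_singular_basis_nonneg:
  assumes basis: "left_singular_basis X e l"
  shows "0 \<le> l i"
proof -
  have "l i = e i \<bullet> (X *v (transpose X *v e i))"
    unfolding left_singular_basisD(3)[OF basis] by (simp add: left_singular_basisD(1)[OF basis])
  also have "\<dots> = (transpose X *v e i) \<bullet> (transpose X *v e i)"
    by (simp add: dot_lmul_matrix[symmetric])
  finally show ?thesis by simp
qed

lemma singular_value_nonneg:
  fixes X :: "real ^ 'm ^ 'n"
  assumes "k \<in> {1..CARD('n)}"
  shows "0 \<le> singular_value k X"
proof -
  obtain e l where "left_singular_basis X e l" by (rule left_singular_basis_exists)
  from singular_value_ge_iff[OF this assms, of 0] left_singular_basis_nonneg[OF this]
  show ?thesis using assms by simp
qed

text \<open>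
  If the \<open>k\<close>-th singular value were positive, the basis would have \<open>k\<close> vectors with a nonzero
  eigenvalue, all in the range of \<open>X\<close>, whose dimension is the rank.
\<close>

lemma singular_value_eq_0:
  fixes X :: "real ^ 'm ^ 'n"
  assumes "k \<in> {1..CARD('n)}" and "rank X < k"
  shows "singular_value k X = 0"
proof (rule ccontr)
  define s where "s = singular_value k X"
  assume "singular_value k X \<noteq> 0"
  then have "s > 0" using singular_value_nonneg[OF assms(1), of X] by (simp add: s_def)
  obtain e l where basis: "left_singular_basis X e l" by (rule left_singular_basis_exists)
  note orth = left_singular_basisD(1)[OF basis] and eig = left_singular_basisD(3)[OF basis]
  let ?H = "{i. s\<^sup>2 \<le> l i}"
  have "k \<le> card ?H" using singular_value_ge_iff[OF basis assms(1), of s] \<open>s > 0\<close> by (simp add: s_def)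
  have inj: "inj_on e ?H"
    by (rule inj_onI) (metis (full_types) orth zero_neq_one)
  have "pairwise orthogonal (e ` ?H)" by (auto simp: pairwise_def orthogonal_def orth)
  moreover have "0 \<notin> e ` ?H" by (metis imageE inner_zero_left orth zero_neq_one)
  ultimately have ind: "independent (e ` ?H)" by (rule pairwise_orthogonal_independent)
  have "e ` ?H \<subseteq> range ((*v) X)"
  proof safe
    fix i assume "s\<^sup>2 \<le> l i"
    then have "l i \<noteq> 0" using \<open>s > 0\<close> zero_less_power[of s 2] by linarith
    then have "e i = X *v ((1 / l i) *\<^sub>R (transpose X *v e i))"
      unfolding matrix_vector_mult_scaleR eig by simp
    then show "e i \<in> range ((*v) X)" by blast
  qed
  then have "card (e ` ?H) \<le> rank X"
    unfolding rank_dim_range using ind by (rule independent_card_le_dim)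
  with \<open>k \<le> card ?H\<close> assms(2) show False by (simp add: card_image[OF inj])
qed

text \<open>
  One half of the Courant-Fischer principle. Nonzero vectors orthogonal to all \<open>e i\<close> with
  eigenvalue at least \<open>c\<^sup>2\<close> are stretched by less than \<open>c\<close>, so \<open>V\<close> contains none of them. The orthogonal
  projection \<open>p\<close> onto the span of these \<open>e i\<close> is therefore injective on \<open>V\<close>, and there are at
  least \<open>dim V\<close> such \<open>e i\<close>.
\<close>

lemma singular_value_ge_if_expanding_on_subspace:
  fixes X :: "real ^ 'm ^ 'n"
  assumes k: "k \<in> {1..dim V}" and V: "subspace V" and c: "0 \<le> c"
    and expand: "\<And>x. x \<in> V \<Longrightarrow> c * norm x \<le> norm (transpose X *v x)"
  shows "c \<le> singular_value k X"
proof -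
  have "dim V \<le> DIM(real ^ 'n)" by (rule dim_subset_UNIV)
  then have k': "k \<in> {1..CARD('n)}" using k by simp
  obtain e l where basis: "left_singular_basis X e l" by (rule left_singular_basis_exists)
  note orth = left_singular_basisD(1)[OF basis] and exp = left_singular_basisD(2)[OF basis]
    and eig = left_singular_basisD(3)[OF basis]
  have norm2: "x \<bullet> x = (\<Sum>i\<in>UNIV. (x \<bullet> e i)\<^sup>2)" for x
  proof -
    have "x \<bullet> x = x \<bullet> (\<Sum>i\<in>UNIV. (x \<bullet> e i) *\<^sub>R e i)" by (simp only: exp)
    then show ?thesis by (simp add: inner_sum_right power2_eq_square)
  qed
  have image2: "(transpose X *v x) \<bullet> (transpose X *v x) = (\<Sum>i\<in>UNIV. l i * (x \<bullet> e i)\<^sup>2)" for x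
  proof -
    have adjoint: "(X *v (transpose X *v x)) \<bullet> e i = l i * (x \<bullet> e i)" for i
    proof -
      have "(X *v (transpose X *v x)) \<bullet> e i = x \<bullet> (X *v (transpose X *v e i))"
        by (metis dot_lmul_matrix inner_commute transpose_matrix_vector)
      then show ?thesis unfolding eig by simp
    qed
    have "(transpose X *v x) \<bullet> (transpose X *v x) = (X *v (transpose X *v x)) \<bullet> x"
      by (metis dot_lmul_matrix inner_commute transpose_matrix_vector)
    also have "\<dots> = (X *v (transpose X *v x)) \<bullet> (\<Sum>i\<in>UNIV. (x \<bullet> e i) *\<^sub>R e i)" by (simp only: exp)
    also have "\<dots> = (\<Sum>i\<in>UNIV. (x \<bullet> e i) * ((X *v (transpose X *v x)) \<bullet> e i))"
      by (simp add: inner_sum_right)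
    also have "\<dots> = (\<Sum>i\<in>UNIV. (x \<bullet> e i) * (l i * (x \<bullet> e i)))"
      by (simp only: adjoint)
    finally show ?thesis by (simp add: power2_eq_square mult.left_commute)
  qed
  let ?H = "{i. c\<^sup>2 \<le> l i}"
  define p where "p x = (\<Sum>i\<in>?H. (x \<bullet> e i) *\<^sub>R e i)" for x
  have lin: "linear p"
    by (intro linearI)
      (simp_all add: p_def inner_add_left scaleR_left_distrib sum.distrib scaleR_sum_right)
  have kernel: "x = 0" if "x \<in> V" "p x = 0" for x
  proof -
    have H0: "x \<bullet> e j = 0" if "j \<in> ?H" for j
    proof -
      have "0 = p x \<bullet> e j" by (simp add: \<open>p x = 0\<close>)
      also have "\<dots> = (\<Sum>i\<in>?H. if i = j then x \<bullet> e i else 0)"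
        by (simp add: p_def inner_sum_left orth if_distrib cong: if_cong)
      also have "\<dots> = x \<bullet> e j" using that by (subst sum.delta) auto
      finally show ?thesis by simp
    qed
    have "(c * norm x)\<^sup>2 \<le> (norm (transpose X *v x))\<^sup>2"
      using expand[OF \<open>x \<in> V\<close>] c by (intro power_mono) auto
    then have "c\<^sup>2 * (x \<bullet> x) \<le> (transpose X *v x) \<bullet> (transpose X *v x)"
      by (simp add: power_mult_distrib power2_norm_eq_inner)
    then have "(\<Sum>i\<in>UNIV. (c\<^sup>2 - l i) * (x \<bullet> e i)\<^sup>2) \<le> 0"
      unfolding image2 unfolding norm2 by (simp add: left_diff_distrib sum_subtractf sum_distrib_left)
    moreover have terms: "0 \<le> (c\<^sup>2 - l i) * (x \<bullet> e i)\<^sup>2" for i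
      using H0[of i] by (cases "i \<in> ?H") auto
    ultimately have "(\<Sum>i\<in>UNIV. (c\<^sup>2 - l i) * (x \<bullet> e i)\<^sup>2) = 0"
      by (intro antisym sum_nonneg) auto
    then have "\<forall>i. (c\<^sup>2 - l i) * (x \<bullet> e i)\<^sup>2 = 0"
      using terms by (subst (asm) sum_nonneg_eq_0_iff) auto
    then have "x \<bullet> e i = 0" for i
      using H0[of i] by (cases "i \<in> ?H") (auto dest: spec[of _ i])
    then have "x \<bullet> x = 0" by (simp add: norm2)
    then show "x = 0" by simp
  qed
  have "inj_on p V"
    using kernel linear_injective_on_subspace_0[OF lin V] by blast
  then have "dim V = dim (p ` V)" by (subst dim_image_eq[OF lin]) (simp_all add: span_eq_iff[THEN iffD2, OF V])
  also have "\<dots> \<le> card (e ` ?H)"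
    by (rule dim_le_card) (auto simp: p_def intro!: span_sum span_scale intro: span_base)
  also have "\<dots> \<le> card ?H" by (rule card_image_le) simp
  finally show ?thesis using singular_value_ge_iff[OF basis k' c] k by auto
qed

text \<open>
  A crude bound, as any constant serves for the perturbation argument: the image is a combination of
  the rows of \<open>M\<close>.
\<close>

lemma norm_transpose_mult_le:
  fixes M :: "real ^ 'm ^ 'n"
  shows "norm (transpose M *v x) \<le> CARD('n) * norm M * norm x"
proof -
  have "transpose M *v x = (\<Sum>i\<in>UNIV. x $ i *\<^sub>R M $ i)"
    by (simp add: vec_eq_iff matrix_vector_mult_def transpose_def mult.commute)
  also have "norm \<dots> \<le> (\<Sum>i\<in>(UNIV :: 'n set). norm x * norm M)"
    by (intro sum_norm_le) (simp add: mult_mono component_le_norm_cart Finite_Cartesian_Product.norm_nth_le)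
  finally show ?thesis by (simp add: algebra_simps)
qed

text \<open>
  \<open>X\<^sup>T\<close> is injective on the range \<open>V\<close> of \<open>X\<close>, since its kernel is the orthogonal complement of \<open>V\<close>;
  in finite dimension it then stretches \<open>V\<close> by some \<open>b > 0\<close>. For \<open>Y\<close> close to \<open>X\<close>, \<open>Y\<^sup>T\<close> still
  stretches \<open>V\<close> by \<open>b/2\<close>.
\<close>

lemma singular_value_locally_bounded_below:
  fixes X :: "real ^ 'm ^ 'n"
  assumes k: "k \<in> {1..rank X}"
  obtains c d where "c > 0" "d > 0" "\<And>Y. dist X Y < d \<Longrightarrow> c \<le> singular_value k Y"
proof -
  define V where "V = range ((*v) X)"
  have V: "subspace V" unfolding V_def
    by (intro linear_subspace_image) auto
  have "x = 0" if "x \<in> V" "transpose X *v x = 0" for x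
  proof -
    obtain y where "x = X *v y" using \<open>x \<in> V\<close> by (auto simp: V_def)
    then have "x \<bullet> x = (transpose X *v x) \<bullet> y"
      by (metis dot_lmul_matrix transpose_matrix_vector)
    with that show ?thesis by simp
  qed
  then obtain b where b: "b > 0" "\<And>x. x \<in> V \<Longrightarrow> b * norm x \<le> norm (transpose X *v x)"
    using injective_imp_isometric[OF closed_subspace[OF V] V
        matrix_vector_mul_bounded_linear[of "transpose X"]] by blast
  define N where "N = real CARD('n)"
  have N: "N > 0" by (simp add: N_def)
  have "b / 2 \<le> singular_value k Y" if Y: "dist X Y < b / (2 * N)" for Y :: "real ^ 'm ^ 'n"
  proof (rule singular_value_ge_if_expanding_on_subspace[OF _ V])
    show "k \<in> {1..dim V}" using k by (simp add: V_def rank_dim_range)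
    show "b / 2 * norm x \<le> norm (transpose Y *v x)" if "x \<in> V" for x
    proof -
      have "transpose X *v x = transpose Y *v x + transpose (X - Y) *v x"
        by (simp add: transpose_def vec_eq_iff matrix_vector_mult_def left_diff_distrib sum_subtractf)
      then have "norm (transpose X *v x) \<le> norm (transpose Y *v x) + norm (transpose (X - Y) *v x)"
        by (simp add: norm_triangle_ineq)
      also have "norm (transpose (X - Y) *v x) \<le> N * norm (X - Y) * norm x"
        unfolding N_def by (rule norm_transpose_mult_le)
      also have "\<dots> \<le> b / 2 * norm x"
        using Y N by (intro mult_right_mono) (auto simp: dist_norm field_simps)
      finally show ?thesis using b(2)[OF that] by simp
    qed
  qed (use b in simp)
  with b N show ?thesis by (intro that[of "b / 2" "b / (2 * N)"]) auto
qed

section \<open>The sum of the trailing singular values as a residual for the rank\<close>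

lemma nuclear_norm_minus_ky_fan_norm:
  fixes X :: "real ^ 'm ^ 'n"
  assumes "r \<le> CARD('n)"
  shows "nuclear_norm X - ky_fan_norm r X = (\<Sum>i = Suc r..CARD('n). singular_value i X)"
proof -
  have "{1..CARD('n)} = {1..r} \<union> {Suc r..CARD('n)}" using assms by auto
  then have "nuclear_norm X = ky_fan_norm r X + (\<Sum>i = Suc r..CARD('n). singular_value i X)"
    unfolding nuclear_norm_def ky_fan_norm_def by (simp add: sum.union_disjoint)
  then show ?thesis by simp
qed

lemma singular_value_le_ky_fan_tail:
  fixes X :: "real ^ 'm ^ 'n"
  assumes "r < CARD('n)"
  shows "singular_value (Suc r) X \<le> nuclear_norm X - ky_fan_norm r X"
  unfolding nuclear_norm_minus_ky_fan_norm[OF less_imp_le[OF assms]]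
  by (rule member_le_sum[of "Suc r" _ "\<lambda>i. singular_value i X"])
    (use assms in \<open>auto intro!: singular_value_nonneg\<close>)

lemma ky_fan_tail_nonneg:
  fixes X :: "real ^ 'm ^ 'n"
  assumes "r \<le> CARD('n)"
  shows "0 \<le> nuclear_norm X - ky_fan_norm r X"
  unfolding nuclear_norm_minus_ky_fan_norm[OF assms]
  by (intro sum_nonneg singular_value_nonneg) auto

lemma ky_fan_tail_locally_bounded_below:
  fixes X :: "real ^ 'm ^ 'n"
  assumes "r < rank X"
  shows "\<exists>c>0. \<exists>d>0. \<forall>Y. dist X Y < d \<longrightarrow> c \<le> nuclear_norm Y - ky_fan_norm r Y"
proof -
  have "rank X \<le> CARD('n)" using rank_bound[of X] by simp
  then have r: "r < CARD('n)" using assms by simp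
  from assms have "Suc r \<in> {1..rank X}" by simp
  from singular_value_locally_bounded_below[OF this] show ?thesis
    using singular_value_le_ky_fan_tail[OF r] order_trans by metis
qed

lemma ky_fan_tail_eq_0_iff:
  fixes X :: "real ^ 'm ^ 'n"
  assumes "r \<le> CARD('n)"
  shows "nuclear_norm X - ky_fan_norm r X = 0 \<longleftrightarrow> rank X \<le> r"
proof
  assume "nuclear_norm X - ky_fan_norm r X = 0"
  then show "rank X \<le> r"
    using ky_fan_tail_locally_bounded_below[of r X] by (metis dist_self not_le)
next
  assume "rank X \<le> r"
  then show "nuclear_norm X - ky_fan_norm r X = 0"
    unfolding nuclear_norm_minus_ky_fan_norm[OF assms]
    by (intro sum.neutral) (auto intro!: singular_value_eq_0)
qed

section \<open>From calmness to an error bound on compact sets\<close>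

text \<open>
  Each point of \<open>\<Omega>\<close> has a neighbourhood on which the bound holds with a constant of its own: at a
  zero of \<open>\<phi>\<close> by calmness, applied to the level set through the nearby point, and elsewhere because
  the distance is bounded above and \<open>\<phi>\<close> below. Compactness leaves finitely many constants.
\<close>

lemma calm_level_sets_imp_error_bound:
  fixes \<phi> :: "'z::euclidean_space \<Rightarrow> real"
  assumes \<Omega>: "closed \<Omega>" "\<Omega> \<subseteq> Z" and \<Delta>: "compact \<Delta>"
    and S: "\<And>\<tau>. S \<tau> = {X \<in> \<Omega>. \<phi> X = \<tau>}"
    and nonneg: "\<And>X. 0 \<le> \<phi> X"
    and below: "\<And>X. \<phi> X \<noteq> 0 \<Longrightarrow> \<exists>c>0. \<exists>d>0. \<forall>Y. dist X Y < d \<longrightarrow> c \<le> \<phi> Y"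
    and calm: "\<And>X. X \<in> S 0 \<Longrightarrow> calm_at Z S 0 X"
  shows "\<exists>\<kappa>>0. \<forall>X\<in>\<Delta> \<inter> \<Omega>. infdist X (S 0) \<le> \<kappa> * \<phi> X"
proof -
  have "\<exists>d>0. \<exists>\<kappa>\<ge>0. \<forall>Y\<in>ball X d \<inter> \<Omega>. infdist Y (S 0) \<le> \<kappa> * \<phi> Y" if "X \<in> \<Omega>" for X
  proof (cases "\<phi> X = 0")
    case True
    then have X0: "X \<in> S 0" using that by (simp add: S)
    from calm[OF this] obtain \<gamma> \<epsilon> \<delta> where pos: "\<gamma> \<ge> 0" "\<epsilon> > 0" "\<delta> > 0"
      and incl: "\<And>\<tau>. norm (\<tau> - 0) \<le> \<epsilon> \<Longrightarrow> S \<tau> \<inter> (cball X \<delta> \<inter> Z) \<subseteq>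
        {z + (\<gamma> * norm (\<tau> - 0)) *\<^sub>R u | z u. z \<in> S 0 \<and> u \<in> cball 0 1 \<inter> Z}"
      unfolding calm_at_def by blast
    \<comment> \<open>Calmness covers small residuals only. Residuals above \<open>\<epsilon>\<close> cost the term \<open>\<delta> / \<epsilon>\<close>, as \<open>X\<close>
      itself is within \<open>\<delta>\<close>.\<close>
    have "infdist Y (S 0) \<le> (\<gamma> + \<delta> / \<epsilon>) * \<phi> Y" if Y: "Y \<in> ball X \<delta>" "Y \<in> \<Omega>" for Y
    proof (cases "\<phi> Y \<le> \<epsilon>")
      case True
      have "Y \<in> S (\<phi> Y) \<inter> (cball X \<delta> \<inter> Z)" using Y \<Omega> by (auto simp: S)
      moreover have "norm (\<phi> Y - 0) \<le> \<epsilon>" using True nonneg[of Y] by simp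
      ultimately obtain z u where "Y = z + (\<gamma> * norm (\<phi> Y - 0)) *\<^sub>R u" "z \<in> S 0" "norm u \<le> 1"
        using incl by fastforce
      then have z: "Y = z + (\<gamma> * \<phi> Y) *\<^sub>R u" "z \<in> S 0" "norm u \<le> 1"
        using nonneg[of Y] by simp_all
      have "dist Y z = \<gamma> * \<phi> Y * norm u"
        using nonneg[of Y] pos by (subst z(1)) (simp add: dist_norm)
      also have "\<dots> \<le> \<gamma> * \<phi> Y"
        using z(3) nonneg[of Y] pos by (intro mult_left_le) auto
      also have "\<dots> \<le> (\<gamma> + \<delta> / \<epsilon>) * \<phi> Y"
        using pos nonneg[of Y] by (intro mult_right_mono) auto
      finally show ?thesis using z(2) by (rule infdist_le2[rotated])
    next
      case False
      have "dist Y X \<le> \<delta>" using Y by (simp add: dist_commute)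
      also have "\<delta> = \<delta> / \<epsilon> * \<epsilon>" using pos by simp
      also have "\<dots> \<le> (\<gamma> + \<delta> / \<epsilon>) * \<phi> Y"
        using pos False by (intro mult_mono) auto
      finally show ?thesis using X0 by (rule infdist_le2[rotated])
    qed
    then show ?thesis using pos by (intro exI[of _ \<delta>] conjI exI[of _ "\<gamma> + \<delta> / \<epsilon>"]) auto
  next
    case False
    from below[OF this] obtain c d where pos: "c > 0" "d > 0"
      and c: "\<And>Y. dist X Y < d \<Longrightarrow> c \<le> \<phi> Y" by blast
    let ?D = "infdist X (S 0) + d"
    have "infdist Y (S 0) \<le> ?D / c * \<phi> Y" if "Y \<in> ball X d" for Y
    proof -
      have "infdist Y (S 0) \<le> infdist X (S 0) + dist Y X" by (rule infdist_triangle)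
      also have "\<dots> \<le> ?D" using that by (simp add: dist_commute)
      also have "?D = ?D / c * c" using pos by simp
      also have "\<dots> \<le> ?D / c * \<phi> Y"
        using c[of Y] that pos infdist_nonneg[of X "S 0"] by (intro mult_left_mono) auto
      finally show ?thesis .
    qed
    then show ?thesis using pos infdist_nonneg[of X "S 0"]
      by (intro exI[of _ d] conjI exI[of _ "?D / c"]) auto
  qed
  then obtain d \<kappa> where d: "\<And>X. X \<in> \<Omega> \<Longrightarrow> d X > 0"
    and \<kappa>: "\<And>X. X \<in> \<Omega> \<Longrightarrow> \<kappa> X \<ge> 0"
    and local: "\<And>X Y. X \<in> \<Omega> \<Longrightarrow> Y \<in> ball X (d X) \<Longrightarrow> Y \<in> \<Omega> \<Longrightarrow>
      infdist Y (S 0) \<le> \<kappa> X * \<phi> Y"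
    by (metis (no_types, lifting) Int_iff)
  have "compact (\<Delta> \<inter> \<Omega>)" using \<Delta> \<Omega>(1) by (rule compact_Int_closed)
  moreover have "\<Delta> \<inter> \<Omega> \<subseteq> (\<Union>X\<in>\<Delta> \<inter> \<Omega>. ball X (d X))" using d by force
  ultimately obtain F where F: "F \<subseteq> \<Delta> \<inter> \<Omega>" "finite F" "\<Delta> \<inter> \<Omega> \<subseteq> (\<Union>X\<in>F. ball X (d X))"
    using compactE_image[of "\<Delta> \<inter> \<Omega>" "\<Delta> \<inter> \<Omega>" "\<lambda>X. ball X (d X)"] by auto
  have sum_nonneg: "0 \<le> sum \<kappa> F" using F \<kappa> by (intro sum_nonneg) auto
  \<comment> \<open>The sum dominates each local constant; the summand \<open>1\<close> makes it positive even if all of them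
    vanish.\<close>
  have "infdist Y (S 0) \<le> (1 + sum \<kappa> F) * \<phi> Y" if Y: "Y \<in> \<Delta> \<inter> \<Omega>" for Y
  proof -
    obtain X where X: "X \<in> F" "Y \<in> ball X (d X)" using F Y by blast
    then have "infdist Y (S 0) \<le> \<kappa> X * \<phi> Y" using F Y by (intro local) auto
    also have "\<kappa> X \<le> sum \<kappa> F" using F \<kappa> X by (intro member_le_sum) auto
    then have "\<kappa> X * \<phi> Y \<le> (1 + sum \<kappa> F) * \<phi> Y"
      using nonneg by (intro mult_right_mono) auto
    finally show ?thesis .
  qed
  then show ?thesis using sum_nonneg by (intro exI[of _ "1 + sum \<kappa> F"]) auto
qed

text \<open>
  The ambient set \<open>Z\<close> is either the whole matrix space or the subspace of symmetric matrices, so that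
  both cases of the theorem are instances.
\<close>

lemma calm_imp_rank_error_bound:
  fixes \<Omega> \<Delta> Z :: "(real ^ 'm ^ 'n) set"
  assumes \<Omega>: "closed \<Omega>" "\<Omega> \<subseteq> Z" and \<Delta>: "compact \<Delta>" and r: "r \<le> CARD('n)"
    and calm: "\<And>X. X \<in> S_map \<Omega> r 0 \<Longrightarrow> calm_at Z (S_map \<Omega> r) 0 X"
  shows "\<exists>\<kappa>>0. \<forall>X\<in>\<Delta> \<inter> \<Omega>.
    infdist X (rank_constrained \<Omega> r) \<le> \<kappa> * (nuclear_norm X - ky_fan_norm r X)"
proof -
  have zero: "S_map \<Omega> r 0 = rank_constrained \<Omega> r"
    unfolding S_map_def rank_constrained_def ky_fan_tail_eq_0_iff[OF r] ..
  have "\<exists>\<kappa>>0. \<forall>X\<in>\<Delta> \<inter> \<Omega>. infdist X (S_map \<Omega> r 0) \<le> \<kappa> * (nuclear_norm X - ky_fan_norm r X)"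
  proof (rule calm_level_sets_imp_error_bound[OF \<Omega> \<Delta> _ ky_fan_tail_nonneg[OF r] _ calm])
    show "S_map \<Omega> r \<tau> = {X \<in> \<Omega>. nuclear_norm X - ky_fan_norm r X = \<tau>}" for \<tau>
      by (rule S_map_def)
    show "\<exists>c>0. \<exists>d>0. \<forall>Y. dist X Y < d \<longrightarrow> c \<le> nuclear_norm Y - ky_fan_norm r Y"
      if "nuclear_norm X - ky_fan_norm r X \<noteq> 0" for X :: "real ^ 'm ^ 'n"
      using that unfolding ky_fan_tail_eq_0_iff[OF r] by (intro ky_fan_tail_locally_bounded_below) simp
  qed
  then show ?thesis unfolding zero .
qed

lemma closed_symmetric_matrices: "closed (symmetric_matrices :: (real ^ 'n ^ 'n) set)"
proof -
  have "symmetric_matrices = (\<Inter>i j. {X :: real ^ 'n ^ 'n. X $ j $ i = X $ i $ j})"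
    by (auto simp: symmetric_matrices_def transpose_def vec_eq_iff)
  moreover have "closed \<dots>"
    by (intro closed_INT ballI closed_Collect_eq continuous_intros)
  ultimately show ?thesis by simp
qed

theorem theorem3p3:
  shows
    "(CARD('n::finite) \<le> CARD('m::finite) \<longrightarrow>
       (\<forall>(\<Omega> :: (real ^ 'm ^ 'n) set) (\<Delta> :: (real ^ 'm ^ 'n) set) (r :: nat).
          closed \<Omega> \<longrightarrow> r \<in> {1..CARD('n)} \<longrightarrow> rank_constrained \<Omega> r \<noteq> {} \<longrightarrow>
          compact \<Delta> \<longrightarrow>
          (\<forall>X \<in> S_map \<Omega> r 0. calm_at UNIV (S_map \<Omega> r) 0 X) \<longrightarrow>
          (\<exists>\<kappa>>0. \<forall>X \<in> \<Delta> \<inter> \<Omega>.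
             infdist X (rank_constrained \<Omega> r) \<le> \<kappa> * (nuclear_norm X - ky_fan_norm r X))))
     \<and>
     (\<forall>(\<Omega> :: (real ^ 'n ^ 'n) set) (\<Delta> :: (real ^ 'n ^ 'n) set) (r :: nat).
          closedin (top_of_set symmetric_matrices) \<Omega> \<longrightarrow>
          r \<in> {1..CARD('n)} \<longrightarrow> rank_constrained \<Omega> r \<noteq> {} \<longrightarrow>
          \<Delta> \<subseteq> symmetric_matrices \<longrightarrow> compact \<Delta> \<longrightarrow>
          (\<forall>X \<in> S_map \<Omega> r 0. calm_at symmetric_matrices (S_map \<Omega> r) 0 X) \<longrightarrow>
          (\<exists>\<kappa>>0. \<forall>X \<in> \<Delta> \<inter> \<Omega>.
             infdist X (rank_constrained \<Omega> r) \<le> \<kappa> * (nuclear_norm X - ky_fan_norm r X)))"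
proof (intro conjI impI allI)
  fix \<Omega> \<Delta> :: "(real ^ 'm ^ 'n) set" and r
  assume "closed \<Omega>" "r \<in> {1..CARD('n)}" "rank_constrained \<Omega> r \<noteq> {}" "compact \<Delta>"
    "\<forall>X \<in> S_map \<Omega> r 0. calm_at UNIV (S_map \<Omega> r) 0 X"
  then show "\<exists>\<kappa>>0. \<forall>X \<in> \<Delta> \<inter> \<Omega>.
      infdist X (rank_constrained \<Omega> r) \<le> \<kappa> * (nuclear_norm X - ky_fan_norm r X)"
    by (intro calm_imp_rank_error_bound[where Z = UNIV]) auto
next
  fix \<Omega> \<Delta> :: "(real ^ 'n ^ 'n) set" and r
  assume \<Omega>: "closedin (top_of_set symmetric_matrices) \<Omega>" and "r \<in> {1..CARD('n)}"
    "rank_constrained \<Omega> r \<noteq> {}" "compact \<Delta>"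
    "\<forall>X \<in> S_map \<Omega> r 0. calm_at symmetric_matrices (S_map \<Omega> r) 0 X"
  then show "\<exists>\<kappa>>0. \<forall>X \<in> \<Delta> \<inter> \<Omega>.
      infdist X (rank_constrained \<Omega> r) \<le> \<kappa> * (nuclear_norm X - ky_fan_norm r X)"
    using closedin_closed_trans[OF \<Omega> closed_symmetric_matrices] closedin_subset[OF \<Omega>]
    by (intro calm_imp_rank_error_bound[where Z = symmetric_matrices]) auto
qed

end
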